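(* Let $q$ be a prime power, $\mathbb{F}=\mathbb{F}_q$, $n\ge1$ and $i\in[n]$. Then \[ |\mathcal{C}^{i}_{*,*}|=q!\sum_{k=1}^{q}\frac{(-1)^{k-1}q^{(q-k)q^{n-1}}}{(q-k)!}\sum_{\substack{k_1+\cdots+k_q=k\\ 0\le k_j\le q}}\frac{1}{k_1!k_2!\cdots k_q!}. \]
   Context: $[n]=\{1,\dots,n\}$. For $i\in[n]$ and $a,b\in\mathbb{F}$, $\mathcal{C}^i_{a,b}$ denotes the set of all functions $f:\mathbb{F}^n\to\mathbb{F}$ with $f(x_1,\dots,x_{i-1},a,x_{i+1},\dots,x_n)=b$ for all $(x_1,\dots,x_n)\in\mathbb{F}^n$. $\mathcal{C}^i_{*,*}=\bigcup_{a\in\mathbb{F}}\bigcup_{b\in\mathbb{F}}\mathcal{C}^i_{a,b}$, the set of functions canalyzing in the $i$th variable with some canalyzing input value and some canalyzed output value. *)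

theory Defs
  imports "HOL-Analysis.Finite_Cartesian_Product" "HOL-Library.FuncSet"
    "HOL-Number_Theory.Prime_Powers"
begin

definition canalyzing :: "'n::finite \<Rightarrow> 'a \<Rightarrow> 'a \<Rightarrow> ('a ^ 'n \<Rightarrow> 'a) set" where
  "canalyzing i a b = {f. \<forall>x. f (\<chi> j. if j = i then a else x $ j) = b}"

definition canalyzing_some :: "'n::finite \<Rightarrow> ('a ^ 'n \<Rightarrow> 'a) set" where
  "canalyzing_some i = (\<Union>a. \<Union>b. canalyzing i a b)"

text \<open>
  The tuples \<open>(k\<^sub>1, \<dots>, k\<^sub>q)\<close> with \<open>0 \<le> k\<^sub>j \<le> q\<close> and sum \<open>k\<close>, as extensional functions on
  \<open>{1..q}\<close>, so that each tuple is represented exactly once.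
\<close>
definition bounded_compositions :: "nat \<Rightarrow> nat \<Rightarrow> (nat \<Rightarrow> nat) set" where
  "bounded_compositions q k = {c \<in> {1..q} \<rightarrow>\<^sub>E {0..q}. (\<Sum>j=1..q. c j) = k}"

end

theory Submission imports Defs begin

text \<open>
  A function on \<open>\<F>\<^sup>n\<close> is the same as a family of its \<open>q\<close> slices over the hyperplanes \<open>x\<^sub>i = a\<close>, each of
  which has \<open>q\<^bsup>n-1\<^esup>\<close> points. It fails to be canalyzing in the \<open>i\<close>th variable iff no slice is
  constant, so the number of non-canalyzing functions is \<open>(q\<^bsup>N\<^esup> - q)\<^sup>q\<close> with \<open>N = q\<^bsup>n-1\<^esup>\<close>. Expanding this
  power gives \<open>\<Sum>\<^sub>k (-1)\<^sup>k (q choose k) q\<^sup>k q\<^bsup>(q-k)N\<^esup>\<close>, whose \<open>k = 0\<close> term counts all functions. By the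
  multinomial theorem, \<open>q\<^sup>k / k!\<close> is the inner sum over compositions; the bound \<open>k\<^sub>j \<le> q\<close> is vacuous
  because \<open>k \<le> q\<close>.
\<close>

text \<open>Induction on \<open>I\<close>: the value \<open>j\<close> at the new index leaves a
  composition of \<open>k - j\<close> over the old set, and the binomial theorem for
  \<open>1 + card I\<close> collects the terms. Since \<open>k \<le> m\<close>, the cap
  \<open>m\<close> excludes none of the values \<open>j \<le> k\<close>; \<open>k\<close> must vary
  in the induction.\<close>

lemma sum_inverse_fact_compositions:
  fixes I :: "'i set"
  assumes "finite I" "k \<le> m"
  shows "(\<Sum>c | c \<in> I \<rightarrow>\<^sub>E {0..m} \<and> sum c I = k. 1 / (\<Prod>j\<in>I. fact (c j))) = real (card I) ^ k / fact k"
  using assms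
proof (induction I arbitrary: k rule: finite_induct)
  case empty
  \<comment> \<open>Only the empty tuple exists, so the sum is 1 for \<open>k = 0\<close> and 0
    otherwise, which is \<open>0 ^ k\<close>.\<close>
  have "{c. c \<in> {} \<rightarrow>\<^sub>E {0..m} \<and> sum c {} = k} = (if k = 0 then {\<lambda>x::'i. undefined} else {})"
    by auto
  then show ?case by (simp add: power_0_left)
next
  case (insert i I)
  define C where "C J l = {c. c \<in> J \<rightarrow>\<^sub>E {0..m} \<and> sum c J = l}" for J :: "'i set" and l
  define w where "w J c = 1 / (\<Prod>j\<in>J. fact (c j) :: real)" for J :: "'i set" and c :: "'i \<Rightarrow> nat"
  have sum_upd: "(\<Sum>x\<in>I. if x = i then j else c x) = sum c I" for c :: "'i \<Rightarrow> nat" and j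
    using insert.hyps by (intro sum.cong) auto
  have prod_upd: "(\<Prod>x\<in>I. fact ((c(i := j)) x) :: real) = (\<Prod>x\<in>I. fact (c x))" for c :: "'i \<Rightarrow> nat" and j
    using insert.hyps by (intro prod.cong) auto
  have fin: "finite (C I l)" for l
    using finite_subset[OF _ finite_PiE[OF insert.hyps(1), of "\<lambda>_. {0..m}"]] unfolding C_def by auto
  have bij: "bij_betw (\<lambda>(j, c). c(i := j)) (SIGMA j:{..k}. C I (k - j)) (C (insert i I) k)"
  \<comment> \<open>The inverse reads off the value at \<open>i\<close> and resets it to
    \<open>undefined\<close>, so that the rest is extensional on \<open>I\<close>.\<close>
  proof (rule bij_betw_byWitness[where f' = "\<lambda>c. (c i, c(i := undefined))"])
    show "\<forall>p\<in>SIGMA j:{..k}. C I (k - j). (\<lambda>c. (c i, c(i := undefined))) ((\<lambda>(j, c). c(i := j)) p) = p"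
      using insert.hyps by (auto simp: C_def PiE_def extensional_def fun_eq_iff)
    show "(\<lambda>(j, c). c(i := j)) ` (SIGMA j:{..k}. C I (k - j)) \<subseteq> C (insert i I) k"
      using insert.hyps insert.prems by (auto simp: C_def PiE_iff extensional_def sum_upd)
    show "(\<lambda>c. (c i, c(i := undefined))) ` C (insert i I) k \<subseteq> (SIGMA j:{..k}. C I (k - j))"
      using insert.hyps by (auto simp: C_def PiE_iff extensional_def sum_upd)
  qed auto
  have "sum (w (insert i I)) (C (insert i I) k)
      = (\<Sum>p\<in>(SIGMA j:{..k}. C I (k - j)). w (insert i I) ((\<lambda>(j, c). c(i := j)) p))"
    by (rule sum.reindex_bij_betw[OF bij, symmetric])
  also have "\<dots> = (\<Sum>j\<le>k. \<Sum>c\<in>C I (k - j). w (insert i I) (c(i := j)))"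
    using fin by (subst sum.Sigma) (auto intro!: sum.cong)
  also have "\<dots> = (\<Sum>j\<le>k. 1 / fact j * (\<Sum>c\<in>C I (k - j). w I c))"
    using insert.hyps by (simp add: w_def prod_upd sum_distrib_left del: fun_upd_apply) (simp add: field_simps)
  also have "\<dots> = (\<Sum>j\<le>k. 1 / fact j * (real (card I) ^ (k - j) / fact (k - j)))"
    using insert.IH insert.prems by (simp add: C_def w_def)
  \<comment> \<open>Multiplying 1/(j! (k-j)!) by k! gives a binomial coefficient; the factor
    \<open>1 ^ j\<close> only matches the shape of \<open>binomial_ring\<close>.\<close>
  also have "\<dots> = (\<Sum>j\<le>k. real (k choose j) * 1 ^ j * real (card I) ^ (k - j)) / fact k"
    by (simp add: sum_divide_distrib binomial_fact field_simps)
  also have "\<dots> = real (card (insert i I)) ^ k / fact k"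
    using insert.hyps binomial_ring[of 1 "real (card I)" k] by simp
  finally show ?case by (simp add: C_def w_def)
qed

text \<open>Forgetting the coordinate \<open>i\<close>, which is fixed to \<open>a\<close>, loses
  nothing, and the other coordinates are free.\<close>

lemma card_hyperplane:
  "card {x :: 'a::finite ^ 'n::finite. x $ i = a} = CARD('a) ^ (CARD('n) - 1)"
proof -
  have "bij_betw (\<lambda>x. restrict (($) x) (UNIV - {i})) {x :: 'a ^ 'n. x $ i = a}
      ((UNIV - {i}) \<rightarrow>\<^sub>E UNIV)"
    by (rule bij_betw_byWitness[where f' = "\<lambda>g. \<chi> j. if j = i then a else g j"])
      (auto simp: vec_eq_iff PiE_def extensional_def fun_eq_iff)
  then show ?thesis
    by (auto simp: card_funcsetE dest!: bij_betw_same_card)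
qed

text \<open>The constant functions are removed from all functions; since \<open>S\<close> is
  nonempty, different values \<open>b\<close> give different constants.\<close>

lemma card_nonconstant_funcset:
  assumes "finite S" "S \<noteq> {}"
  shows "card {g \<in> S \<rightarrow>\<^sub>E (UNIV :: 'a::finite set). \<nexists>b. \<forall>x\<in>S. g x = b} = CARD('a) ^ card S - CARD('a)"
proof -
  let ?const = "(\<lambda>b. restrict (\<lambda>_. b) S) ` (UNIV :: 'a set)"
  have "{g \<in> S \<rightarrow>\<^sub>E UNIV. \<nexists>b. \<forall>x\<in>S. g x = b} = (S \<rightarrow>\<^sub>E UNIV) - ?const"
  proof -
    have "g \<in> ?const" if "g \<in> S \<rightarrow>\<^sub>E UNIV" "\<forall>x\<in>S. g x = b" for g b
      using that by (intro image_eqI[of _ _ b]) (auto simp: PiE_def extensional_def fun_eq_iff)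
    moreover have "\<exists>b. \<forall>x\<in>S. g x = b" if "g \<in> ?const" for g
      using that by auto
    ultimately show ?thesis by blast
  qed
  moreover have "inj (\<lambda>b::'a. restrict (\<lambda>_. b) S)"
    using assms(2) by (auto simp: inj_def fun_eq_iff)
  then have "card ?const = CARD('a)"
    by (rule card_image)
  moreover have "?const \<subseteq> S \<rightarrow>\<^sub>E UNIV" by auto
  ultimately show ?thesis
    using assms(1) by (simp add: card_Diff_subset card_funcsetE)
qed

lemma canalyzing_iff:
  fixes i :: "'n::finite" and f :: "'a ^ 'n \<Rightarrow> 'a"
  shows "f \<in> canalyzing i a b \<longleftrightarrow> (\<forall>x. x $ i = a \<longrightarrow> f x = b)"
proof -
  have "f x = b" if "f \<in> canalyzing i a b" "x $ i = a" for x
  proof -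
    have eq: "(\<chi> j. if j = i then a else x $ j) = x"
      using that(2) by (simp add: vec_eq_iff)
    have "f (\<chi> j. if j = i then a else x $ j) = b"
      using that(1) unfolding canalyzing_def by blast
    then show ?thesis
      unfolding eq .
  qed
  then show ?thesis
    by (auto simp: canalyzing_def)
qed

text \<open>Restriction to the hyperplanes turns these functions into independent choices of one
  nonconstant slice for each value of the \<open>i\<close>th coordinate.\<close>

lemma card_not_canalyzing:
  fixes i :: "'n::finite"
  shows "card (- canalyzing_some i :: ('a::finite ^ 'n \<Rightarrow> 'a) set)
    = (CARD('a) ^ CARD('a) ^ (CARD('n) - 1) - CARD('a)) ^ CARD('a)"
proof -
  define S :: "'a \<Rightarrow> ('a ^ 'n) set" where "S a = {x. x $ i = a}" for a
  define T :: "'a \<Rightarrow> ('a ^ 'n \<Rightarrow> 'a) set" where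
    "T a = {g \<in> S a \<rightarrow>\<^sub>E UNIV. \<nexists>b. \<forall>x\<in>S a. g x = b}" for a
  have "(\<chi> j. a) \<in> S a" for a
    by (simp add: S_def)
  then have ne: "S a \<noteq> {}" for a by blast
  have card_T: "card (T a) = CARD('a) ^ CARD('a) ^ (CARD('n) - 1) - CARD('a)" for a
    unfolding T_def card_nonconstant_funcset[OF finite ne] by (simp add: S_def card_hyperplane)
  have "bij_betw (\<lambda>f a. restrict f (S a)) (- canalyzing_some i) (PiE UNIV T)"
  \<comment> \<open>The inverse glues the slices: the hyperplane through \<open>x\<close> is the one
    with index \<open>x $ i\<close>.\<close>
  proof (rule bij_betw_byWitness[where f' = "\<lambda>g x. g (x $ i) x"])
    show "\<forall>g\<in>PiE UNIV T. (\<lambda>a. restrict (\<lambda>x. g (x $ i) x) (S a)) = g"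
    proof
      fix g assume "g \<in> PiE UNIV T"
      then have "g a \<in> extensional (S a)" for a
        by (auto simp: PiE_iff T_def)
      then show "(\<lambda>a. restrict (\<lambda>x. g (x $ i) x) (S a)) = g"
        by (auto simp: S_def extensional_def fun_eq_iff)
    qed
    show "(\<lambda>f a. restrict f (S a)) ` (- canalyzing_some i) \<subseteq> PiE UNIV T"
    proof (rule image_subsetI)
      fix f :: "'a ^ 'n \<Rightarrow> 'a" assume "f \<in> - canalyzing_some i"
      then have "\<exists>x\<in>S a. f x \<noteq> b" for a b
        by (auto simp: S_def canalyzing_some_def canalyzing_iff)
      then show "(\<lambda>a. restrict f (S a)) \<in> PiE UNIV T"
        by (auto simp: T_def)
    qed
    show "(\<lambda>g x. g (x $ i) x) ` PiE UNIV T \<subseteq> - canalyzing_some i"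
    proof (rule image_subsetI)
      fix g assume g: "g \<in> PiE UNIV T"
      have False if "(\<lambda>x. g (x $ i) x) \<in> canalyzing i a b" for a b
      proof -
        have "\<forall>x\<in>S a. g a x = b"
          using that by (auto simp: S_def canalyzing_iff)
        moreover have "g a \<in> T a" using g by auto
        ultimately show False
          unfolding T_def by blast
      qed
      then show "(\<lambda>x. g (x $ i) x) \<in> - canalyzing_some i"
        by (auto simp: canalyzing_some_def)
    qed
  qed (auto simp: S_def)
  then show ?thesis
    by (simp add: bij_betw_same_card card_PiE card_T)
qed

theorem theorem3p17:
  fixes i :: "'n::finite" and q n :: nat
  assumes "primepow q"
    and "CARD('a::{field,finite}) = q"
    and "CARD('n) = n"
  shows "real (card (canalyzing_some i :: ('a ^ 'n \<Rightarrow> 'a) set)) =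
    fact q * (\<Sum>k=1..q. ((-1) ^ (k - 1) * real q ^ ((q - k) * q ^ (n - 1))) / fact (q - k) *
      (\<Sum>c\<in>bounded_compositions q k. 1 / (\<Prod>j=1..q. fact (c j))))"
proof -
  define N where "N = q ^ (n - 1)"
  define t where "t k = real (q choose k) * (- real q) ^ k * (real q ^ N) ^ (q - k)" for k
  have "q > 0" using assms(1) by (rule primepow_gt_0_nat)
  \<comment> \<open>This keeps the natural subtraction \<open>q ^ N - q\<close> from being truncated
    when it is cast to the reals.\<close>
  then have "q \<le> q ^ N"
    by (simp add: N_def self_le_power)
  have "n > 0" using assms(3) by auto
  have card_univ: "CARD('a ^ 'n \<Rightarrow> 'a) = (q ^ N) ^ q"
  proof -
    have "CARD('a ^ 'n \<Rightarrow> 'a) = q ^ q ^ n"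
      using assms \<open>q > 0\<close> by (simp add: card_fun)
    also have "q ^ n = N * q"
      using \<open>n > 0\<close> by (cases n) (auto simp: N_def)
    finally show ?thesis
      by (simp only: power_mult)
  qed
  have "real (card (- canalyzing_some i :: ('a ^ 'n \<Rightarrow> 'a) set)) = (- real q + real q ^ N) ^ q"
    using \<open>q \<le> q ^ N\<close> assms by (simp add: card_not_canalyzing N_def of_nat_diff)
  also have "\<dots> = (\<Sum>k\<le>q. t k)"
    unfolding t_def by (rule binomial_ring)
  also have "\<dots> = real ((q ^ N) ^ q) + (\<Sum>k=1..q. t k)"
    by (simp add: atMost_atLeast0 sum.atLeast_Suc_atMost t_def)
  finally have compl: "real (card (- canalyzing_some i :: ('a ^ 'n \<Rightarrow> 'a) set))
    = real ((q ^ N) ^ q) + (\<Sum>k=1..q. t k)" .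
  have "card (canalyzing_some i :: ('a ^ 'n \<Rightarrow> 'a) set) + card (- canalyzing_some i :: ('a ^ 'n \<Rightarrow> 'a) set)
      = (q ^ N) ^ q" (is "?c + ?d = _")
    unfolding card_univ[symmetric] by (subst card_Un_disjoint[symmetric]) auto
  then have "real ?c + real ?d = real ((q ^ N) ^ q)"
    by (simp only: flip: of_nat_add)
  then have "real ?c = (\<Sum>k=1..q. - t k)"
    using compl by (simp add: sum_negf)
  also have "\<dots> = (\<Sum>k=1..q. fact q * (((-1) ^ (k - 1) * real q ^ ((q - k) * N)) / fact (q - k) *
      (\<Sum>c\<in>bounded_compositions q k. 1 / (\<Prod>j=1..q. fact (c j)))))"
  proof (rule sum.cong[OF refl])
    fix k assume k: "k \<in> {1..q}"
    then have inner: "(\<Sum>c\<in>bounded_compositions q k. 1 / (\<Prod>j=1..q. fact (c j))) = real q ^ k / fact k"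
      using sum_inverse_fact_compositions[of "{1..q}" k q] by (simp add: bounded_compositions_def)
    have "(real q ^ N) ^ (q - k) = real q ^ ((q - k) * N)"
      by (metis power_mult mult.commute)
    \<comment> \<open>As \<open>k \<ge> 1\<close>, \<open>k - 1\<close> is a true predecessor; the
      sign split off here cancels the one in \<open>- t k\<close>.\<close>
    moreover have "(- real q) ^ k = - ((-1) ^ (k - 1) * real q ^ k)"
      using k by (cases k) (auto simp: power_minus[of "real q"])
    moreover have "real (q choose k) = fact q / (fact k * fact (q - k))"
      using k by (simp add: binomial_fact)
    ultimately show "- t k = fact q * (((-1) ^ (k - 1) * real q ^ ((q - k) * N)) / fact (q - k) *
      (\<Sum>c\<in>bounded_compositions q k. 1 / (\<Prod>j=1..q. fact (c j))))"
      unfolding inner t_def by (simp add: mult_ac)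
  qed
  finally show ?thesis
    by (simp add: N_def sum_distrib_left)
qed

end
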